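(* Let $\Delta$ be a semi-regular right-angled building of type $(W,S)$ and let $U$ be its universal group with respect to transitive permutation groups $(G^s)_{s\in S}$. Let $c\in\mathrm{Ch}(\Delta)$ and $s\in S$, and let $\mathcal T$ be the $s$-tree-wall of $c$. Then $$\mathrm{Fix}_U(\mathcal T)=\prod_{d\in\mathcal P_{s,c}}V_s(d).$$
   Context: A Coxeter system $(W,S)$ is right-angled if for all distinct $s,t\in S$ the order of $st$ is $2$ or $\infty$. $\Delta$ is the unique building of type $(W,S)$ in which every $s$-panel has exactly $q_s$ chambers, for given cardinals $q_s\ge2$ $(s\in S)$. $\mathrm{Ch}(\Delta)$ is its set of chambers, $\delta$ its $W$-valued Weyl distance. Distinct chambers $c,d$ are $s$-adjacent if $\delta(c,d)=s$; $s$-panels are the classes of "equal or $s$-adjacent", and $\mathcal P_{s,c}$ is the $s$-panel containing $c$. A residue of type $J\subseteq S$ is a connected component of the graph on chambers keeping only edges with labels in $J$; $\mathrm{proj}_{\mathcal R}(x)$ is the unique chamber of the residue $\mathcal R$ closest to $x$. $\mathrm{Aut}(\Delta)$ is the group of type-preserving automorphisms. An $s$-tree-wall is the set of all $s$-panels contained in a given residue of type $\{s\}\cup\{t\in S\setminus\{s\}:ts=st\}$ (equivalently, a class of parallel $s$-panels); its chambers are the chambers of that residue. $\mathrm{Fix}_U(\mathcal T)$ is the subgroup of elements of $U$ fixing every chamber of $\mathcal T$. The $s$-wing of a chamber $d$ is $X_s(d)=\{x\in\mathrm{Ch}(\Delta)\mid\mathrm{proj}_{\mathcal P_{s,d}}(x)=d\}$,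 and $V_s(d)=\{g\in U\mid g.v=v\text{ for all }v\notin X_s(d)\}$. For distinct $d\in\mathcal P_{s,c}$ the groups $V_s(d)$ have disjoint supports, and the (unrestricted) direct product $\prod_{d\in\mathcal P_{s,c}}V_s(d)$ is viewed as a group of permutations of $\mathrm{Ch}(\Delta)$, a tuple $(g_d)_d$ acting as $g_d$ on $X_s(d)$. Let $|Y_s|=q_s$. A legal $s$-coloring is a map $h_s\colon\mathrm{Ch}(\Delta)\to Y_s$ which is bijective on every $s$-panel and constant on every residue of type $S\setminus\{s\}$. Given legal $s$-colorings $h_s$ and transitive groups $G^s\le\mathrm{Sym}(Y_s)$ for all $s\in S$, the universal group is $$U=\{g\in\mathrm{Aut}(\Delta)\mid (h_s|_{\mathcal P_{s,gc}})\circ g\circ(h_s|_{\mathcal P_{s,c}})^{-1}\in G^s\text{ for all }s\in S,\ c\in\mathrm{Ch}(\Delta)\}.$$ *)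

theory Defs
  imports "HOL-Algebra.Algebra"
begin

unbundle cardinal_syntax

section \<open>Right-angled Coxeter systems\<close>

definition word_prod :: "('w, 'm) monoid_scheme \<Rightarrow> 'w list \<Rightarrow> 'w" where
  "word_prod W ws = foldr (\<otimes>\<^bsub>W\<^esub>) ws \<one>\<^bsub>W\<^esub>"

text \<open>
  The relator \<open>(s t)\<^sup>m\<close> with \<open>m\<close> the order of \<open>s t\<close>. Since \<^const>\<open>group.ord\<close> is \<open>0\<close> on
  elements of infinite order, \<open>m = \<infinity>\<close> gives the empty relator, that is, no relation.
  For \<open>s = t\<close> the relator is \<open>s s\<close>.
\<close>
definition relator :: "('w, 'm) monoid_scheme \<Rightarrow> 'w \<Rightarrow> 'w \<Rightarrow> 'w list" where
  "relator W s t = concat (replicate (group.ord W (s \<otimes>\<^bsub>W\<^esub> t)) [s, t])"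

inductive relator_insertion :: "('w, 'm) monoid_scheme \<Rightarrow> 'w set \<Rightarrow> 'w list \<Rightarrow> 'w list \<Rightarrow> bool"
  for W S where
  "\<lbrakk>us \<in> lists S; vs \<in> lists S; s \<in> S; t \<in> S\<rbrakk>
    \<Longrightarrow> relator_insertion W S (us @ vs) (us @ relator W s t @ vs)"

text \<open>
  The assumption \<open>presentation\<close> says that \<open>W\<close> is presented by the generators \<open>S\<close> and the
  relations \<open>(s t)\<^sup>m = 1\<close>, \<open>m\<close> the order of \<open>s t\<close>. Words without formal inverses suffice, because the
  relators \<open>s s\<close> make every letter its own inverse.
\<close>
locale coxeter_system = group W for W (structure) +
  fixes S :: "'a set"
  assumes gens_closed: "S \<subseteq> carrier W"
    and gens_order: "s \<in> S \<Longrightarrow> ord s = 2"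
    and generates: "generate W S = carrier W"
    and presentation:
      "\<lbrakk>ws \<in> lists S; word_prod W ws = \<one>\<rbrakk> \<Longrightarrow> equivclp (relator_insertion W S) ws []"

locale right_angled_coxeter_system = coxeter_system +
  assumes right_angled: "\<lbrakk>s \<in> S; t \<in> S; s \<noteq> t\<rbrakk> \<Longrightarrow> ord (s \<otimes> t) = 2 \<or> ord (s \<otimes> t) = 0"

definition word_length :: "('w, 'm) monoid_scheme \<Rightarrow> 'w set \<Rightarrow> 'w \<Rightarrow> nat" where
  "word_length W S w = (LEAST n. \<exists>ws \<in> lists S. length ws = n \<and> word_prod W ws = w)"


section \<open>Buildings\<close>

text \<open>
  Buildings of type \<open>(W, S)\<close> as \<open>W\<close>-metric spaces: \<open>Ch\<close> is the set of chambers and \<open>\<delta>\<close> the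
  Weyl distance.
\<close>
locale building = coxeter_system +
  fixes Ch :: "'c set" and \<delta> :: "'c \<Rightarrow> 'c \<Rightarrow> 'a"
  assumes chambers_nonempty: "Ch \<noteq> {}"
    and Weyl_closed: "\<lbrakk>x \<in> Ch; y \<in> Ch\<rbrakk> \<Longrightarrow> \<delta> x y \<in> carrier W"
    and WD1: "\<lbrakk>x \<in> Ch; y \<in> Ch\<rbrakk> \<Longrightarrow> \<delta> x y = \<one> \<longleftrightarrow> x = y"
    and WD2: "\<lbrakk>x \<in> Ch; y \<in> Ch; x' \<in> Ch; s \<in> S; \<delta> x' x = s\<rbrakk>
      \<Longrightarrow> \<delta> x' y \<in> {s \<otimes> \<delta> x y, \<delta> x y}"
    and WD2_longer: "\<lbrakk>x \<in> Ch; y \<in> Ch; x' \<in> Ch; s \<in> S; \<delta> x' x = s;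
        word_length W S (s \<otimes> \<delta> x y) = word_length W S (\<delta> x y) + 1\<rbrakk>
      \<Longrightarrow> \<delta> x' y = s \<otimes> \<delta> x y"
    and WD3: "\<lbrakk>x \<in> Ch; y \<in> Ch; s \<in> S\<rbrakk>
      \<Longrightarrow> \<exists>x' \<in> Ch. \<delta> x' x = s \<and> \<delta> x' y = s \<otimes> \<delta> x y"

locale right_angled_building = building + right_angled_coxeter_system

definition panel :: "'c set \<Rightarrow> ('c \<Rightarrow> 'c \<Rightarrow> 'w) \<Rightarrow> 'w \<Rightarrow> 'c \<Rightarrow> 'c set" where
  "panel Ch \<delta> s c = {d \<in> Ch. d = c \<or> \<delta> c d = s}"

text \<open>The residue of type \<open>J\<close> containing \<open>c\<close>.\<close>
definition residue :: "'c set \<Rightarrow> ('c \<Rightarrow> 'c \<Rightarrow> 'w) \<Rightarrow> 'w set \<Rightarrow> 'c \<Rightarrow> 'c set" where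
  "residue Ch \<delta> J c = {d. (c, d) \<in> {(x, y). x \<in> Ch \<and> y \<in> Ch \<and> \<delta> x y \<in> J}\<^sup>*}"

text \<open>The distance between chambers \<open>x\<close> and \<open>y\<close> is the length of \<open>\<delta> x y\<close>.\<close>
definition proj :: "('w, 'm) monoid_scheme \<Rightarrow> 'w set \<Rightarrow> ('c \<Rightarrow> 'c \<Rightarrow> 'w) \<Rightarrow> 'c set \<Rightarrow> 'c \<Rightarrow> 'c" where
  "proj W S \<delta> R x = (THE y. is_arg_min (\<lambda>z. word_length W S (\<delta> x z)) (\<lambda>z. z \<in> R) y)"

locale semi_regular_right_angled_building = right_angled_building +
  fixes q :: "'a \<Rightarrow> 'k rel"
  assumes q_cardinal: "s \<in> S \<Longrightarrow> Card_order (q s)"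
    and q_ge_2: "s \<in> S \<Longrightarrow> ctwo \<le>o q s"
    and panel_card: "\<lbrakk>s \<in> S; x \<in> Ch\<rbrakk> \<Longrightarrow> |panel Ch \<delta> s x| =o q s"

text \<open>
  Permutations of a set are the elements of its \<^const>\<open>BijGroup\<close>, hence extensional functions.
  An automorphism of a \<open>W\<close>-metric space is type-preserving iff it preserves \<open>\<delta>\<close> itself
  (rather than \<open>\<delta>\<close> up to a diagram automorphism).
\<close>
definition Aut :: "'c set \<Rightarrow> ('c \<Rightarrow> 'c \<Rightarrow> 'w) \<Rightarrow> ('c \<Rightarrow> 'c) set" where
  "Aut Ch \<delta> = {g \<in> carrier (BijGroup Ch). \<forall>x \<in> Ch. \<forall>y \<in> Ch. \<delta> (g x) (g y) = \<delta> x y}"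


section \<open>Tree-walls and wings\<close>

definition tree_wall ::
    "('w, 'm) monoid_scheme \<Rightarrow> 'w set \<Rightarrow> 'c set \<Rightarrow> ('c \<Rightarrow> 'c \<Rightarrow> 'w) \<Rightarrow> 'w \<Rightarrow> 'c \<Rightarrow> 'c set set" where
  "tree_wall W S Ch \<delta> s c =
    (let R = residue Ch \<delta> ({s} \<union> {t \<in> S - {s}. t \<otimes>\<^bsub>W\<^esub> s = s \<otimes>\<^bsub>W\<^esub> t}) c
     in {P. (\<exists>x \<in> Ch. P = panel Ch \<delta> s x) \<and> P \<subseteq> R})"

definition wing ::
    "('w, 'm) monoid_scheme \<Rightarrow> 'w set \<Rightarrow> 'c set \<Rightarrow> ('c \<Rightarrow> 'c \<Rightarrow> 'w) \<Rightarrow> 'w \<Rightarrow> 'c \<Rightarrow> 'c set" where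
  "wing W S Ch \<delta> s d = {x \<in> Ch. proj W S \<delta> (panel Ch \<delta> s d) x = d}"

definition Fix :: "('c \<Rightarrow> 'c) set \<Rightarrow> 'c set set \<Rightarrow> ('c \<Rightarrow> 'c) set" where
  "Fix U T = {g \<in> U. \<forall>x \<in> \<Union>T. g x = x}"

definition V_group ::
    "('w, 'm) monoid_scheme \<Rightarrow> 'w set \<Rightarrow> 'c set \<Rightarrow> ('c \<Rightarrow> 'c \<Rightarrow> 'w) \<Rightarrow> ('c \<Rightarrow> 'c) set
      \<Rightarrow> 'w \<Rightarrow> 'c \<Rightarrow> ('c \<Rightarrow> 'c) set" where
  "V_group W S Ch \<delta> U s d = {g \<in> U. \<forall>v \<in> Ch - wing W S Ch \<delta> s d. g v = v}"

text \<open>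
  The unrestricted direct product of the groups \<open>V\<^sub>s(d)\<close>, \<open>d\<close> in the \<open>s\<close>-panel of \<open>c\<close>, viewed as
  a set of maps on \<open>Ch\<close>: the tuple \<open>\<gamma>\<close> acts as \<open>\<gamma> d\<close> on the \<open>s\<close>-wing of \<open>d\<close>. The wings
  partition \<open>Ch\<close>, so \<open>\<gamma>\<close> determines \<open>g\<close>.
\<close>
definition prod_V ::
    "('w, 'm) monoid_scheme \<Rightarrow> 'w set \<Rightarrow> 'c set \<Rightarrow> ('c \<Rightarrow> 'c \<Rightarrow> 'w) \<Rightarrow> ('c \<Rightarrow> 'c) set
      \<Rightarrow> 'w \<Rightarrow> 'c \<Rightarrow> ('c \<Rightarrow> 'c) set" where
  "prod_V W S Ch \<delta> U s c =
    {g \<in> extensional Ch.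
      \<exists>\<gamma> \<in> carrier (product_group (panel Ch \<delta> s c)
                (\<lambda>d. (BijGroup Ch)\<lparr>carrier := V_group W S Ch \<delta> U s d\<rparr>)).
        \<forall>d \<in> panel Ch \<delta> s c. \<forall>x \<in> wing W S Ch \<delta> s d. g x = \<gamma> d x}"


section \<open>Colorings and universal groups\<close>

definition legal_coloring ::
    "'w set \<Rightarrow> 'c set \<Rightarrow> ('c \<Rightarrow> 'c \<Rightarrow> 'w) \<Rightarrow> 'w \<Rightarrow> 'y set \<Rightarrow> ('c \<Rightarrow> 'y) \<Rightarrow> bool" where
  "legal_coloring S Ch \<delta> s Y h \<longleftrightarrow>
    h \<in> Ch \<rightarrow> Y \<and>
    (\<forall>x \<in> Ch. bij_betw h (panel Ch \<delta> s x) Y) \<and>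
    (\<forall>x \<in> Ch. \<forall>y \<in> residue Ch \<delta> (S - {s}) x. h y = h x)"

definition transitive_perm_group :: "'y set \<Rightarrow> ('y \<Rightarrow> 'y) set \<Rightarrow> bool" where
  "transitive_perm_group Y H \<longleftrightarrow>
    subgroup H (BijGroup Y) \<and> transitive_action ((BijGroup Y)\<lparr>carrier := H\<rparr>) Y (\<lambda>g. g)"

definition local_action ::
    "'c set \<Rightarrow> ('c \<Rightarrow> 'c \<Rightarrow> 'w) \<Rightarrow> 'w \<Rightarrow> 'y set \<Rightarrow> ('c \<Rightarrow> 'y) \<Rightarrow> ('c \<Rightarrow> 'c) \<Rightarrow> 'c \<Rightarrow> 'y \<Rightarrow> 'y" where
  "local_action Ch \<delta> s Y h g c =
    (\<lambda>y \<in> Y. restrict h (panel Ch \<delta> s (g c)) (g (inv_into (panel Ch \<delta> s c) h y)))"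

definition universal_group ::
    "'w set \<Rightarrow> 'c set \<Rightarrow> ('c \<Rightarrow> 'c \<Rightarrow> 'w) \<Rightarrow> ('w \<Rightarrow> 'y set) \<Rightarrow> ('w \<Rightarrow> 'c \<Rightarrow> 'y)
      \<Rightarrow> ('w \<Rightarrow> ('y \<Rightarrow> 'y) set) \<Rightarrow> ('c \<Rightarrow> 'c) set" where
  "universal_group S Ch \<delta> Y h G =
    {g \<in> Aut Ch \<delta>. \<forall>s \<in> S. \<forall>c \<in> Ch. local_action Ch \<delta> s (Y s) (h s) g c \<in> G s}"

end

theory Submission
  imports Defs
begin

text \<open>
  Let \<open>R\<close> be the residue of type \<open>{s} \<union> s\<^sup>\<bottom>\<close> containing \<open>c\<close>, where \<open>s\<^sup>\<bottom>\<close> is the set of generators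
  other than \<open>s\<close> that commute with \<open>s\<close>; it is the set of chambers of the tree-wall. Two facts say
  that the wings of the chambers of the panel of \<open>c\<close> touch each other only along \<open>R\<close>.

  First, if adjacent chambers \<open>x\<close> and \<open>y\<close> lie in distinct wings, then both lie in \<open>R\<close> and they are
  \<open>s\<close>-adjacent (\<open>adjacent_in_distinct_wings\<close>). If \<open>w\<close> is the Weyl distance from \<open>x\<close> to its projection
  on the panel and \<open>t\<close> is the type of the adjacency, then comparing lengths and folding give
  \<open>t w = w s\<close> with \<open>w s\<close> longer than \<open>w\<close>. In a right-angled Coxeter group this is possible
  only if \<open>t = s\<close> and all letters of a reduced word of \<open>w\<close> lie in \<open>s\<^sup>\<bottom>\<close>
  (\<open>wall_stabiliser_letters\<close>), because two descents of one element always commute there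
  (\<open>descents_commute\<close>). Secondly, the chambers of an \<open>s\<close>-panel inside \<open>R\<close> lie in
  pairwise distinct wings (\<open>tree_wall_panel_wings\<close>).

  Membership in the universal group can be tested one panel at a time: a map that agrees on every
  panel with some element of the group, possibly a different one for each panel, is itself in the
  group (\<open>universal_group_panelwise\<close>). Hence elements of the group that fix \<open>R\<close> chamberwise
  can be glued freely along the wings (\<open>universal_group_glue_wings\<close>): a panel inside one wing sees
  only one of them, and a panel that meets several wings is contained in \<open>R\<close>, where all of them
  are the identity.

  Both inclusions are instances of the gluing. For \<open>g\<close> fixing the tree-wall, the component at \<open>d\<close> is
  \<open>g\<close> on the wing of \<open>d\<close> glued with the identity on the other wings. Conversely an element of
  the product is glued from its components; these fix \<open>R\<close> because an \<open>s\<close>-panel in \<open>R\<close> has at most one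
  chamber in the wing of \<open>d\<close>, and a permutation of a panel that fixes all chambers but one fixes
  that one too (\<open>V_group_fixes_tree_wall\<close>).
\<close>

section \<open>Walls and descents in right-angled Coxeter groups\<close>

text \<open>
  The parity of the number of times that the path in the Cayley graph from \<open>1\<close> along the word
  crosses the wall of the reflection \<open>r\<close>. The first step crosses it iff \<open>r\<close> is the first letter
  \<open>a\<close>; the rest of the path, translated back to \<open>1\<close>, is then tested against \<open>a r a\<close>. Allowing
  arbitrary group elements \<open>r\<close> avoids singling out the reflections.
\<close>
primrec crosses :: "('w, 'm) monoid_scheme \<Rightarrow> 'w list \<Rightarrow> 'w \<Rightarrow> bool" where
  "crosses W [] r = False"
| "crosses W (a # ws) r = ((r = a) \<noteq> crosses W ws (a \<otimes>\<^bsub>W\<^esub> r \<otimes>\<^bsub>W\<^esub> a))"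

primrec alternating :: "nat \<Rightarrow> 'w \<Rightarrow> 'w \<Rightarrow> 'w list" where
  "alternating 0 p q = []"
| "alternating (Suc k) p q = p # alternating k q p"

context coxeter_system
begin

abbreviation len :: "'a \<Rightarrow> nat" where "len \<equiv> word_length W S"
abbreviation wprod :: "'a list \<Rightarrow> 'a" where "wprod \<equiv> word_prod W"

lemma gen_closed [simp, intro]: "s \<in> S \<Longrightarrow> s \<in> carrier W"
  using gens_closed by auto

lemma gen_square [simp]: "s \<in> S \<Longrightarrow> s \<otimes> s = \<one>"
  using pow_ord_eq_1[of s] gens_order[of s] by (simp add: numeral_2_eq_2)

lemma gen_inv [simp]: "s \<in> S \<Longrightarrow> inv s = s"
  by (simp add: inv_equality)

lemma gen_cancel [simp]: "\<lbrakk>s \<in> S; x \<in> carrier W\<rbrakk> \<Longrightarrow> s \<otimes> (s \<otimes> x) = x"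
  by (simp add: m_assoc[symmetric])

lemma gen_cancel_right [simp]: "\<lbrakk>s \<in> S; x \<in> carrier W\<rbrakk> \<Longrightarrow> x \<otimes> s \<otimes> s = x"
  by (simp add: m_assoc)

lemma ord_two_commute:
  assumes "s \<in> S" "t \<in> S" "ord (s \<otimes> t) = 2"
  shows "s \<otimes> t = t \<otimes> s"
proof -
  have "(s \<otimes> t) \<otimes> (s \<otimes> t) = \<one>"
    using pow_ord_eq_1[of "s \<otimes> t"] assms by (simp add: numeral_2_eq_2)
  then have "s \<otimes> t = inv (s \<otimes> t)"
    using assms by (metis gen_closed inv_equality m_closed)
  then show ?thesis using assms by (simp add: inv_mult_group)
qed

lemma gen_neq_one: "s \<in> S \<Longrightarrow> s \<noteq> \<one>"
  using gens_order[of s] ord_eq_1[of s] by auto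

lemma wprod_Nil [simp]: "wprod [] = \<one>"
  by (simp add: word_prod_def)

lemma wprod_Cons [simp]: "wprod (a # ws) = a \<otimes> wprod ws"
  by (simp add: word_prod_def)

lemma wprod_closed [simp]: "ws \<in> lists S \<Longrightarrow> wprod ws \<in> carrier W"
  by (induction ws) auto

lemma wprod_append [simp]:
  "\<lbrakk>us \<in> lists S; vs \<in> lists S\<rbrakk> \<Longrightarrow> wprod (us @ vs) = wprod us \<otimes> wprod vs"
  by (induction us) (auto simp: m_assoc)

lemma wprod_rev: "ws \<in> lists S \<Longrightarrow> wprod (rev ws) = inv (wprod ws)"
  by (induction ws) (auto simp: inv_mult_group in_lists_conv_set)

lemma ex_word:
  assumes "w \<in> carrier W"
  shows "\<exists>ws \<in> lists S. wprod ws = w"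
proof -
  have "w \<in> generate W S" using assms generates by simp
  then show ?thesis
  proof (induction rule: generate.induct)
    case one
    show ?case by (rule bexI[of _ "[]"]) auto
  next
    case (incl h)
    then show ?case by (intro bexI[of _ "[h]"]) auto
  next
    case (inv h)
    then show ?case by (intro bexI[of _ "[h]"]) auto
  next
    case (eng h1 h2)
    then obtain us vs where "us \<in> lists S" "vs \<in> lists S" "wprod us = h1" "wprod vs = h2" by auto
    then show ?case by (intro bexI[of _ "us @ vs"]) auto
  qed
qed

lemma ex_reduced_word:
  assumes "w \<in> carrier W"
  obtains ws where "ws \<in> lists S" "wprod ws = w" "length ws = len w"
proof -
  have "\<exists>n. \<exists>ws \<in> lists S. length ws = n \<and> wprod ws = w"
    using ex_word[OF assms] by auto
  then have "\<exists>ws \<in> lists S. length ws = len w \<and> wprod ws = w"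
    unfolding word_length_def by (rule LeastI_ex)
  then show ?thesis using that by auto
qed

lemma len_le: "ws \<in> lists S \<Longrightarrow> len (wprod ws) \<le> length ws"
  unfolding word_length_def by (rule Least_le) auto

lemma len_inv: assumes "w \<in> carrier W" shows "len (inv w) = len w"
proof -
  have le: "len (inv v) \<le> len v" if "v \<in> carrier W" for v
  proof -
    obtain vs where vs: "vs \<in> lists S" "wprod vs = v" "length vs = len v"
      using ex_reduced_word \<open>v \<in> carrier W\<close> by blast
    have "len (wprod (rev vs)) \<le> length (rev vs)"
      using vs(1) by (intro len_le) (auto simp: in_lists_conv_set)
    then show ?thesis using vs by (simp add: wprod_rev)
  qed
  show ?thesis using le[OF assms] le[of "inv w"] assms by simp
qed

lemma len_gen_mult_le: assumes "s \<in> S" "w \<in> carrier W" shows "len (s \<otimes> w) \<le> len w + 1"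
proof -
  obtain ws where ws: "ws \<in> lists S" "wprod ws = w" "length ws = len w"
    using ex_reduced_word[OF assms(2)] by blast
  show ?thesis using len_le[of "s # ws"] ws assms by simp
qed

lemma len_mult_gen: "\<lbrakk>s \<in> S; w \<in> carrier W\<rbrakk> \<Longrightarrow> len (w \<otimes> s) = len (s \<otimes> inv w)"
  using len_inv[of "w \<otimes> s"] by (simp add: inv_mult_group)

lemma reduced_tail:
  assumes "a # ws \<in> lists S" "length (a # ws) = len (wprod (a # ws))"
  shows "length ws = len (wprod ws)"
  using len_le[of ws] len_gen_mult_le[of a "wprod ws"] assms by simp

lemma conj_eq_iff:
  assumes "u \<in> carrier W" "r \<in> carrier W" "b \<in> carrier W"
  shows "inv u \<otimes> r \<otimes> u = b \<longleftrightarrow> r \<otimes> u = u \<otimes> b"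
  using assms by (metis inv_solve_left m_assoc m_closed inv_closed)

lemma crosses_append:
  assumes "us \<in> lists S" "vs \<in> lists S" "r \<in> carrier W"
  shows "crosses W (us @ vs) r =
    (crosses W us r \<noteq> crosses W vs (inv (wprod us) \<otimes> r \<otimes> wprod us))"
  using assms
proof (induction us arbitrary: r)
  case Nil
  then show ?case by simp
next
  case (Cons a us)
  have "inv (wprod us) \<otimes> (a \<otimes> r \<otimes> a) \<otimes> wprod us
      = inv (wprod (a # us)) \<otimes> r \<otimes> wprod (a # us)"
    using Cons.prems Cons.hyps by (simp add: inv_mult_group m_assoc)
  then show ?case using Cons by auto
qed

end

context right_angled_coxeter_system
begin

lemma relator_cases:
  assumes "s \<in> S" "t \<in> S"
  shows "relator W s t = [s, t] \<and> s = t \<or>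
    relator W s t = [s, t, s, t] \<and> s \<otimes> t = t \<otimes> s \<or> relator W s t = []"
proof (cases "s = t")
  case True
  then show ?thesis using assms ord_eq_1[of \<one>] by (simp add: relator_def)
next
  case False
  consider "ord (s \<otimes> t) = 2" | "ord (s \<otimes> t) = 0"
    using right_angled[OF assms False] by auto
  then show ?thesis
  proof cases
    case 1
    then show ?thesis using ord_two_commute assms by (simp add: relator_def numeral_2_eq_2)
  next
    case 2
    then show ?thesis by (simp add: relator_def)
  qed
qed

lemma commute_conj_gen:
  "\<lbrakk>s \<in> S; t \<in> S; s \<otimes> t = t \<otimes> s; r \<in> carrier W\<rbrakk> \<Longrightarrow> t \<otimes> r \<otimes> t = s \<longleftrightarrow> r = s"
  by (metis gen_cancel gen_cancel_right gen_closed m_assoc m_closed)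

text \<open>
  A path that runs around a relator crosses every wall an even number of times. In the right-angled
  case the only nonempty relators are \<open>s s\<close> and the square \<open>s t s t\<close>, which crosses the walls of \<open>s\<close> and of
  \<open>t\<close> twice each.
\<close>
lemma crosses_relator:
  assumes "s \<in> S" "t \<in> S" "vs \<in> lists S" "r \<in> carrier W"
  shows "crosses W (relator W s t @ vs) r = crosses W vs r"
  using relator_cases[OF assms(1,2)]
proof (elim disjE conjE)
  assume "relator W s t = [s, t]" "s = t"
  then show ?thesis
    using assms commute_conj_gen[of t t r] by (auto simp: m_assoc[of t "t \<otimes> r" t] m_assoc[of t r t])
next
  assume rel: "relator W s t = [s, t, s, t]" and comm: "s \<otimes> t = t \<otimes> s"
  let ?r = "t \<otimes> (s \<otimes> r \<otimes> s) \<otimes> t"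
  have e1: "s \<otimes> r \<otimes> s = t \<longleftrightarrow> r = t" using commute_conj_gen[of t s r] comm assms by simp
  have e2: "?r = s \<longleftrightarrow> r = s"
    using commute_conj_gen[of s t "s \<otimes> r \<otimes> s"] commute_conj_gen[of s s r] comm assms by simp
  have e3: "s \<otimes> ?r \<otimes> s = t \<longleftrightarrow> r = t"
    using commute_conj_gen[of t s ?r] commute_conj_gen[of t t "s \<otimes> r \<otimes> s"] e1 comm assms by simp
  have st: "t \<otimes> s \<otimes> (t \<otimes> s) = \<one>"
    using assms comm by (metis gen_cancel gen_closed gen_square m_assoc m_closed)
  have ts: "s \<otimes> t \<otimes> (s \<otimes> t) = \<one>" using st comm by simp
  have "t \<otimes> (s \<otimes> ?r \<otimes> s) \<otimes> t = (t \<otimes> s \<otimes> (t \<otimes> s)) \<otimes> r \<otimes> (s \<otimes> t \<otimes> (s \<otimes> t))"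
    using assms(1,2,4) by (simp add: m_assoc)
  then have e4: "t \<otimes> (s \<otimes> ?r \<otimes> s) \<otimes> t = r" using st ts assms by simp
  show ?thesis using e1 e2 e3 e4 by (auto simp: rel)
qed simp

lemma wprod_relator:
  assumes "s \<in> S" "t \<in> S"
  shows "relator W s t \<in> lists S \<and> wprod (relator W s t) = \<one>"
  using relator_cases[OF assms]
proof (elim disjE conjE)
  assume "relator W s t = [s, t, s, t]" "s \<otimes> t = t \<otimes> s"
  moreover from this(2) have "s \<otimes> (t \<otimes> (s \<otimes> t)) = \<one>" using assms by simp
  ultimately show ?thesis using assms by simp
qed (use assms in simp_all)

lemma crosses_equiv:
  assumes "equivclp (relator_insertion W S) ws vs" "r \<in> carrier W"
  shows "crosses W ws r = crosses W vs r"
proof -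
  have step: "crosses W ws r = crosses W vs r" if "relator_insertion W S ws vs" for ws vs
    using that
  proof cases
    case (1 us vs s t)
    then have "relator W s t \<in> lists S" by (simp add: wprod_relator)
    then show ?thesis
      using 1 assms(2) crosses_append[of us vs r] crosses_append[of us "relator W s t @ vs" r]
        crosses_relator[of s t vs "inv (wprod us) \<otimes> r \<otimes> wprod us"] by simp
  qed
  show ?thesis using assms(1)
    by (induction rule: equivclp_induct) (auto dest: step)
qed

text \<open>
  By the presentation, a word with trivial product crosses every wall evenly. Closing both words
  with the same return path \<open>rev vs\<close> compares their parities.
\<close>
lemma crosses_cong:
  assumes "us \<in> lists S" "vs \<in> lists S" "wprod us = wprod vs" "r \<in> carrier W"
  shows "crosses W us r = crosses W vs r"
proof -
  have rev: "rev vs \<in> lists S" using assms(2) by (auto simp: in_lists_conv_set)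
  have triv: "\<not> crosses W (xs @ rev vs) r" if "xs \<in> lists S" "wprod xs = wprod vs" for xs
  proof -
    have "wprod (xs @ rev vs) = \<one>" using that rev assms(2) by (simp add: wprod_rev)
    then show ?thesis
      using crosses_equiv[OF presentation] that rev assms(4) by (metis append_in_lists_conv crosses.simps(1))
  qed
  show ?thesis
    using triv[of us] triv[of vs] rev assms by (simp add: crosses_append)
qed

text \<open>
  The parity for any word of \<open>w\<close>: whether the wall of \<open>r\<close> separates \<open>1\<close> from \<open>w\<close>. All words
  of \<open>w\<close> give the same answer.
\<close>
definition separates :: "'a \<Rightarrow> 'a \<Rightarrow> bool" where
  "separates r w \<longleftrightarrow> (\<exists>ws \<in> lists S. wprod ws = w \<and> crosses W ws r)"

lemma separates_wprod:
  "\<lbrakk>ws \<in> lists S; r \<in> carrier W\<rbrakk> \<Longrightarrow> separates r (wprod ws) = crosses W ws r"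
  unfolding separates_def using crosses_cong by blast

lemma separates_mult:
  assumes "u \<in> carrier W" "v \<in> carrier W" "r \<in> carrier W"
  shows "separates r (u \<otimes> v) = (separates r u \<noteq> separates (inv u \<otimes> r \<otimes> u) v)"
proof -
  obtain us vs where "us \<in> lists S" "wprod us = u" "vs \<in> lists S" "wprod vs = v"
    using ex_word assms by meson
  then show ?thesis
    using separates_wprod[of "us @ vs" r] separates_wprod[of us r]
      separates_wprod[of vs "inv u \<otimes> r \<otimes> u"] crosses_append[of us vs r] assms
    by auto
qed

lemma separates_gen: "\<lbrakk>s \<in> S; r \<in> carrier W\<rbrakk> \<Longrightarrow> separates r s \<longleftrightarrow> r = s"
  using separates_wprod[of "[s]" r] by simp

lemma separates_gen_mult:
  "\<lbrakk>s \<in> S; v \<in> carrier W; r \<in> carrier W\<rbrakk>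
    \<Longrightarrow> separates r (s \<otimes> v) = ((r = s) \<noteq> separates (s \<otimes> r \<otimes> s) v)"
  by (simp add: separates_mult separates_gen)

lemma separates_mult_gen:
  "\<lbrakk>s \<in> S; v \<in> carrier W; r \<in> carrier W\<rbrakk>
    \<Longrightarrow> separates r (v \<otimes> s) = (separates r v \<noteq> (r \<otimes> v = v \<otimes> s))"
  by (simp add: separates_mult separates_gen conj_eq_iff)

text \<open>
  The exchange condition: reflecting the part of the path beyond the crossed wall deletes
  the letter at the crossing.
\<close>
lemma crosses_deletion:
  assumes "ws \<in> lists S" "r \<in> carrier W" "crosses W ws r"
  shows "\<exists>vs \<in> lists S. length vs < length ws \<and> wprod vs = r \<otimes> wprod ws"
  using assms
proof (induction ws arbitrary: r)
  case (Cons a ws)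
  show ?case
  proof (cases "r = a")
    case True
    then show ?thesis using Cons.hyps by (intro bexI[of _ ws]) auto
  next
    case False
    then have "crosses W ws (a \<otimes> r \<otimes> a)" using Cons.prems by simp
    then obtain vs where vs: "vs \<in> lists S" "length vs < length ws"
        "wprod vs = (a \<otimes> r \<otimes> a) \<otimes> wprod ws"
      using Cons.IH[of "a \<otimes> r \<otimes> a"] Cons.hyps Cons.prems by auto
    have "wprod (a # vs) = r \<otimes> wprod (a # ws)"
      using vs Cons.prems Cons.hyps by (simp add: m_assoc)
    then show ?thesis using vs Cons.hyps by (intro bexI[of _ "a # vs"]) auto
  qed
qed simp

lemma separates_shortens:
  assumes "w \<in> carrier W" "r \<in> carrier W" "separates r w"
  shows "len (r \<otimes> w) < len w"
proof -
  obtain ws where ws: "ws \<in> lists S" "wprod ws = w" "length ws = len w"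
    using ex_reduced_word[OF assms(1)] by blast
  then have "crosses W ws r" using assms separates_wprod by blast
  then show ?thesis using crosses_deletion[OF ws(1) assms(2)] ws len_le by fastforce
qed

lemma not_separates_lengthens:
  assumes "w \<in> carrier W" "s \<in> S" "\<not> separates s w"
  shows "len (s \<otimes> w) = len w + 1"
proof -
  have "separates s (s \<otimes> w)" using assms by (simp add: separates_gen_mult)
  then have "len w < len (s \<otimes> w)"
    using separates_shortens[of "s \<otimes> w" s] assms by simp
  then show ?thesis using len_gen_mult_le[of s w] assms by simp
qed

lemma separates_iff:
  "\<lbrakk>w \<in> carrier W; s \<in> S\<rbrakk> \<Longrightarrow> separates s w \<longleftrightarrow> len (s \<otimes> w) < len w"
  using separates_shortens not_separates_lengthens by fastforce

lemma len_gen_mult_cases: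
  "\<lbrakk>w \<in> carrier W; s \<in> S\<rbrakk> \<Longrightarrow> len (s \<otimes> w) < len w \<or> len (s \<otimes> w) = len w + 1"
  using separates_shortens not_separates_lengthens by fastforce

lemma len_mult_gen_cases:
  "\<lbrakk>w \<in> carrier W; s \<in> S\<rbrakk> \<Longrightarrow> len (w \<otimes> s) < len w \<or> len (w \<otimes> s) = len w + 1"
  using len_gen_mult_cases[of "inv w" s] by (simp add: len_mult_gen len_inv)

text \<open>
  Between \<open>w\<close> and \<open>w s\<close> the answer to the question whether the wall of \<open>t\<close> separates from \<open>1\<close>
  changes, so this step crosses the wall of \<open>t\<close>.
\<close>
lemma folding:
  assumes "s \<in> S" "t \<in> S" "w \<in> carrier W"
    and "len (t \<otimes> w) = len w + 1" "len (t \<otimes> (w \<otimes> s)) < len (w \<otimes> s)"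
  shows "t \<otimes> w = w \<otimes> s"
  using assms separates_mult_gen[of s w t] separates_iff[of w t] separates_iff[of "w \<otimes> s" t] by auto

lemma alternating_lists: "\<lbrakk>p \<in> S; q \<in> S\<rbrakk> \<Longrightarrow> alternating k p q \<in> lists S"
  by (induction k arbitrary: p q) auto

lemma dihedral_alternating:
  assumes "p \<in> S" "q \<in> S" "xs \<in> lists {p, q}"
  shows "\<exists>k. wprod xs = wprod (alternating k p q) \<or> wprod xs = wprod (alternating k q p)"
  using assms(3)
proof (induction xs)
  case Nil
  show ?case by (rule exI[of _ 0]) simp
next
  case (Cons a xs)
  have step: "\<exists>k. wprod (a # ys) = wprod (alternating k a b) \<or> wprod (a # ys) = wprod (alternating k b a)"
    if "a \<in> S" "b \<in> S" "wprod ys = wprod (alternating k a b) \<or> wprod ys = wprod (alternating k b a)" for a b k ys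
  proof (cases "wprod ys = wprod (alternating k b a)")
    case True
    then show ?thesis by (intro exI[of _ "Suc k"]) simp
  next
    case False
    then have eq: "wprod ys = wprod (alternating k a b)" using that by simp
    show ?thesis
    proof (cases k)
      case 0
      then show ?thesis using eq by (intro exI[of _ "Suc 0"]) simp
    next
      case (Suc j)
      then have "wprod (a # ys) = wprod (alternating j b a)"
        using eq that alternating_lists[of b a j] by simp
      then show ?thesis by blast
    qed
  qed
  obtain k where "wprod xs = wprod (alternating k p q) \<or> wprod xs = wprod (alternating k q p)"
    using Cons by auto
  then show ?case using step[of p q xs k] step[of q p xs k] Cons.hyps assms by auto
qed

text \<open>
  In an infinite dihedral group the walls crossed by a path that starts with \<open>p\<close> are those of
  \<open>p\<close>, \<open>p q p\<close>, \<dots>, and none of these equals \<open>q\<close>. The induction removes the first letter, which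
  interchanges \<open>p\<close> with \<open>q\<close> and lengthens the reflection; hence the odd alternating products in
  place of \<open>q\<close>.
\<close>
lemma not_crosses_alternating:
  assumes "p \<in> S" "q \<in> S" and inf: "\<And>i. (q \<otimes> p) [^] Suc i \<noteq> \<one>"
  shows "\<not> crosses W (alternating k p q) ((q \<otimes> p) [^] (j::nat) \<otimes> q)"
  using assms
proof (induction k arbitrary: p q j)
  case (Suc k)
  have pq: "p \<otimes> q = inv (q \<otimes> p)" using Suc.prems by (simp add: inv_mult_group)
  have inf': "(p \<otimes> q) [^] Suc i \<noteq> \<one>" for i
    using Suc.prems pq by (metis gen_closed inv_eq_1_iff inv_closed m_closed nat_pow_closed nat_pow_inv)
  have "(q \<otimes> p) [^] j \<otimes> q \<noteq> p"
  proof
    assume "(q \<otimes> p) [^] j \<otimes> q = p"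
    then have "(q \<otimes> p) [^] j \<otimes> q \<otimes> p = \<one>" using Suc.prems by simp
    then show False using Suc.prems by (auto simp: m_assoc)
  qed
  moreover have "p \<otimes> (q \<otimes> p) [^] i \<otimes> q = (p \<otimes> q) [^] Suc i" for i :: nat
  proof (induction i)
    case (Suc i)
    have "p \<otimes> (q \<otimes> p) [^] Suc i \<otimes> q = (p \<otimes> (q \<otimes> p) [^] i \<otimes> q) \<otimes> (p \<otimes> q)"
      using \<open>p \<in> S\<close> \<open>q \<in> S\<close> by (simp add: m_assoc)
    then show ?case using Suc by simp
  qed (use Suc.prems in simp)
  then have "p \<otimes> ((q \<otimes> p) [^] j \<otimes> q) \<otimes> p = (p \<otimes> q) [^] Suc j \<otimes> p"
    using Suc.prems by (metis gen_closed m_assoc m_closed nat_pow_closed)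
  ultimately show ?case
    using Suc.IH[of q p "Suc j"] Suc.prems inf' by (simp only: alternating.simps crosses.simps) blast
qed simp

text \<open>
  Otherwise \<open>s\<close> and \<open>a\<close> generate an infinite dihedral group \<open>D\<close>. Write \<open>u = x v\<close> with \<open>x\<close> in \<open>D\<close> and
  \<open>v\<close> of least length in \<open>D u\<close>. A reflection of \<open>D\<close> whose wall separates \<open>1\<close> from \<open>v\<close>
  would shorten \<open>v\<close>, so \<open>u\<close> and \<open>x\<close> lie on the same sides of the walls of \<open>s\<close> and \<open>a\<close>.
  But \<open>x\<close> has an alternating word, and so at most one descent.
\<close>
lemma descents_commute:
  assumes "s \<in> S" "a \<in> S" "u \<in> carrier W" "separates s u" "separates a u"
  shows "s \<otimes> a = a \<otimes> s"
proof (rule ccontr)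
  assume noncomm: "s \<otimes> a \<noteq> a \<otimes> s"
  have inf: "(p \<otimes> q) [^] Suc i \<noteq> \<one>" if pq: "p \<in> S" "q \<in> S" "p \<otimes> q \<noteq> q \<otimes> p" for p q i
  proof -
    have "p \<noteq> q" using pq by auto
    have "ord (p \<otimes> q) \<noteq> 2" using ord_two_commute pq by blast
    then have "ord (p \<otimes> q) = 0" using right_angled \<open>p \<noteq> q\<close> pq by blast
    then show ?thesis using pow_eq_id[of "p \<otimes> q" "Suc i"] pq by auto
  qed
  have sub: "xs \<in> lists S" if "xs \<in> lists {s, a}" for xs
    using that assms(1,2) by (auto simp: in_lists_conv_set)
  \<comment> \<open>\<open>xs\<close> leads from \<open>u\<close> to a shortest element \<open>v\<close> of its \<open>D\<close>-coset\<close>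
  obtain xs where xs: "xs \<in> lists {s, a}"
    and minimal: "\<And>ys. ys \<in> lists {s, a} \<Longrightarrow> len (wprod xs \<otimes> u) \<le> len (wprod ys \<otimes> u)"
    using ex_has_least_nat[of "\<lambda>ys. ys \<in> lists {s, a}" "[]" "\<lambda>ys. len (wprod ys \<otimes> u)"] by auto
  define v where "v = wprod xs \<otimes> u"
  define x where "x = wprod (rev xs)"
  have rev: "rev xs \<in> lists {s, a}" using xs by (auto simp: in_lists_conv_set)
  have carr: "v \<in> carrier W" "x \<in> carrier W" and u: "u = x \<otimes> v"
    using sub[OF xs] sub[OF rev] assms(3) unfolding v_def x_def
    by (simp_all add: wprod_rev m_assoc[symmetric])
  have sep: "separates r u = separates r x" if r: "r \<in> {s, a}" for r
  proof -
    have rS: "r \<in> S" using r assms by auto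
    have cancel: "y \<otimes> (inv y \<otimes> z) = z" "inv y \<otimes> (y \<otimes> z) = z"
      if "y \<in> carrier W" "z \<in> carrier W" for y z
      using that by (simp_all add: m_assoc[symmetric])
    have eq: "inv x \<otimes> r \<otimes> x \<otimes> v = wprod (xs @ r # rev xs @ xs) \<otimes> u"
      using sub[OF xs] sub[OF rev] rS assms(3) unfolding v_def x_def by (simp add: wprod_rev m_assoc cancel)
    have "xs @ r # rev xs @ xs \<in> lists {s, a}" using xs rev r by auto
    then have "\<not> len (inv x \<otimes> r \<otimes> x \<otimes> v) < len v"
      using minimal eq v_def by (metis not_le)
    then have "\<not> separates (inv x \<otimes> r \<otimes> x) v"
      using separates_shortens carr rS by (metis gen_closed inv_closed m_closed)
    then show ?thesis using u carr rS separates_mult by auto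
  qed
  obtain k where "x = wprod (alternating k s a) \<or> x = wprod (alternating k a s)"
    using dihedral_alternating[OF assms(1,2) rev] x_def by auto
  moreover have "\<not> separates q (wprod (alternating k p q))"
    if "p \<in> S" "q \<in> S" "q \<otimes> p \<noteq> p \<otimes> q" for p q
    using not_crosses_alternating[OF that(1,2) inf[OF that(2,1,3)], of k 0] that alternating_lists[of p q k]
      separates_wprod by auto
  ultimately show False using sep assms noncomm by auto
qed

text \<open>
  Strip the first letter \<open>a\<close> of the reduced word of \<open>w\<close>. Both \<open>t\<close> and \<open>a\<close> are descents of
  \<open>t w = w s\<close>, hence they commute, and the hypotheses pass on to \<open>a w\<close>.
\<close>
lemma wall_stabiliser_letters:
  assumes "ws \<in> lists S" "length ws = len (wprod ws)" "s \<in> S" "t \<in> S"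
    and "t \<otimes> wprod ws = wprod ws \<otimes> s" "\<not> separates t (wprod ws)"
  shows "t = s \<and> (\<forall>a \<in> set ws. a \<noteq> s \<and> a \<otimes> s = s \<otimes> a)"
  using assms
proof (induction ws)
  case Nil
  then show ?case by simp
next
  case (Cons a ws)
  define v where "v = wprod ws"
  have carr: "a \<in> S" "ws \<in> lists S" using Cons.hyps by auto
  then have v: "v \<in> carrier W" using v_def by simp
  note carr = carr v
  have red: "length ws = len v" using reduced_tail[of a ws] Cons.prems(1) carr v_def by simp
  have eq: "t \<otimes> (a \<otimes> v) = a \<otimes> v \<otimes> s" and nsep: "\<not> separates t (a \<otimes> v)"
    using Cons.prems v_def by auto
  have "separates a (a \<otimes> v)"
    using separates_iff[of "a \<otimes> v" a] red Cons.prems(1) carr v_def by simp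
  then have "a \<noteq> t" and tS: "t \<in> S" and sS: "s \<in> S" using nsep Cons.prems by auto
  have "a \<otimes> (a \<otimes> v) \<noteq> a \<otimes> v \<otimes> s"
    using \<open>a \<noteq> t\<close> eq carr \<open>t \<in> S\<close> by (metis gen_closed m_closed right_cancel)
  then have "separates a (t \<otimes> (a \<otimes> v))"
    using separates_mult_gen[of s "a \<otimes> v" a] \<open>separates a (a \<otimes> v)\<close> eq carr \<open>s \<in> S\<close> by simp
  moreover have "separates t (t \<otimes> (a \<otimes> v))"
    using nsep separates_gen_mult[of t "a \<otimes> v" t] carr \<open>t \<in> S\<close> by simp
  ultimately have comm: "t \<otimes> a = a \<otimes> t"
    using descents_commute carr \<open>t \<in> S\<close> by (metis gen_closed m_closed)
  have "a \<otimes> (t \<otimes> v) = a \<otimes> (v \<otimes> s)"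
    using comm eq carr \<open>t \<in> S\<close> \<open>s \<in> S\<close> by (metis gen_closed m_assoc)
  then have "t \<otimes> v = v \<otimes> s"
    using carr \<open>t \<in> S\<close> \<open>s \<in> S\<close> by (metis gen_cancel gen_closed m_closed)
  moreover have "a \<otimes> t \<otimes> a = t" using comm carr \<open>t \<in> S\<close> by (metis gen_cancel_right gen_closed)
  then have "\<not> separates t v"
    using nsep separates_gen_mult[of a v t] \<open>a \<noteq> t\<close> carr \<open>t \<in> S\<close> by simp
  ultimately show ?case using Cons.IH tS sS red carr \<open>a \<noteq> t\<close> comm v_def by auto
qed

text \<open>
  A path with letters commuting with \<open>s\<close> but different from \<open>s\<close> runs parallel to the wall of \<open>s\<close>.
\<close>
lemma not_separates_commuting:
  assumes "ws \<in> lists {t \<in> S - {s}. t \<otimes> s = s \<otimes> t}" "s \<in> S"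
  shows "\<not> separates s (wprod ws)" "wprod ws \<otimes> s = s \<otimes> wprod ws"
proof -
  have ws: "ws \<in> lists S" using assms by (auto simp: in_lists_conv_set)
  have "\<not> crosses W ws s" using assms(1)
  proof (induction ws)
    case (Cons a ws)
    then have a: "a \<in> S" "a \<noteq> s" "a \<otimes> s = s \<otimes> a" by auto
    then have "a \<otimes> s \<otimes> a = s" using assms(2) by simp
    then show ?case using Cons.IH a by simp
  qed simp
  then show "\<not> separates s (wprod ws)" using separates_wprod ws assms(2) by auto
  show "wprod ws \<otimes> s = s \<otimes> wprod ws" using assms(1)
  proof (induction ws)
    case (Cons a ws)
    have a: "a \<in> S" "a \<otimes> s = s \<otimes> a" and ws: "wprod ws \<in> carrier W"
      using Cons.hyps by (auto intro!: wprod_closed simp: in_lists_conv_set)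
    have "a \<otimes> wprod ws \<otimes> s = a \<otimes> s \<otimes> wprod ws"
      using Cons.IH a(1) ws assms(2) by (simp add: m_assoc)
    also have "\<dots> = s \<otimes> (a \<otimes> wprod ws)"
      using a ws assms(2) by (simp add: m_assoc[of s a "wprod ws"])
    finally show ?case by simp
  qed (use assms(2) in simp)
qed

end

section \<open>Projections onto panels\<close>

primrec gallery :: "'c set \<Rightarrow> ('c \<Rightarrow> 'c \<Rightarrow> 'w) \<Rightarrow> 'c \<Rightarrow> 'w list \<Rightarrow> 'c \<Rightarrow> bool" where
  "gallery Ch \<delta> x [] y = (x = y)"
| "gallery Ch \<delta> x (a # ws) y = (\<exists>z \<in> Ch. \<delta> x z = a \<and> gallery Ch \<delta> z ws y)"

lemma gallery_append:
  "gallery Ch \<delta> x us y \<Longrightarrow> gallery Ch \<delta> y vs z \<Longrightarrow> gallery Ch \<delta> x (us @ vs) z"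
  by (induction us arbitrary: x) auto

lemma gallery_residue:
  assumes "gallery Ch \<delta> x ws y" "x \<in> Ch" "set ws \<subseteq> J"
  shows "y \<in> residue Ch \<delta> J x"
  using assms
proof (induction ws arbitrary: x)
  case Nil
  then show ?case by (simp add: residue_def)
next
  case (Cons a ws)
  then obtain z where "z \<in> Ch" "\<delta> x z = a" "gallery Ch \<delta> z ws y" by auto
  then show ?case using Cons by (auto simp: residue_def intro: converse_rtrancl_into_rtrancl)
qed

lemma residue_closed: "\<lbrakk>c \<in> Ch; x \<in> residue Ch \<delta> J c\<rbrakk> \<Longrightarrow> x \<in> Ch"
  unfolding residue_def by (auto elim: rtranclE)

lemma residue_trans: "\<lbrakk>d \<in> residue Ch \<delta> J c; x \<in> residue Ch \<delta> J d\<rbrakk> \<Longrightarrow> x \<in> residue Ch \<delta> J c"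
  unfolding residue_def by auto

lemma panel_subset_residue:
  assumes "c \<in> Ch" "x \<in> residue Ch \<delta> J c" "s \<in> J"
  shows "panel Ch \<delta> s x \<subseteq> residue Ch \<delta> J c"
proof
  fix y assume y: "y \<in> panel Ch \<delta> s x"
  have "x \<in> Ch" using residue_closed assms by metis
  then have "y \<in> residue Ch \<delta> J x"
    using y assms(3) by (auto simp: panel_def residue_def)
  then show "y \<in> residue Ch \<delta> J c" using residue_trans assms(2) by metis
qed

context right_angled_building
begin

lemma adj_sym:
  assumes "x \<in> Ch" "y \<in> Ch" "s \<in> S" "\<delta> x y = s"
  shows "\<delta> y x = s"
proof -
  have "\<delta> x x = \<one>" using WD1 assms by simp
  then have "s \<otimes> \<delta> y x = \<one> \<or> \<delta> y x = \<one>"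
    using WD2[of y x x s] assms by auto
  moreover have "\<delta> y x \<noteq> \<one>"
  proof
    assume "\<delta> y x = \<one>"
    then have "x = y" using WD1 assms by auto
    then show False using \<open>\<delta> x x = \<one>\<close> assms gen_neq_one by auto
  qed
  moreover have "\<delta> y x \<in> carrier W" using Weyl_closed assms by simp
  ultimately show ?thesis using assms by (metis gen_cancel gen_closed r_one)
qed

lemma ex_gallery:
  assumes "ws \<in> lists S" "x \<in> Ch" "y \<in> Ch" "\<delta> x y = wprod ws"
  shows "gallery Ch \<delta> x ws y"
  using assms
proof (induction ws arbitrary: x)
  case Nil
  then show ?case using WD1 by simp
next
  case (Cons a ws)
  obtain z where z: "z \<in> Ch" "\<delta> z x = a" "\<delta> z y = a \<otimes> \<delta> x y"
    using WD3[of x y a] Cons by auto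
  then have "gallery Ch \<delta> z ws y" using Cons by simp
  then show ?case using z adj_sym[of z x a] Cons by auto
qed

lemma Weyl_reduced_gallery:
  assumes "ws \<in> lists S" "x \<in> Ch" "y \<in> Ch" "gallery Ch \<delta> x ws y" "length ws = len (wprod ws)"
  shows "\<delta> x y = wprod ws"
  using assms
proof (induction ws arbitrary: x)
  case Nil
  then show ?case using WD1 by simp
next
  case (Cons a ws)
  obtain z where z: "z \<in> Ch" "\<delta> x z = a" "gallery Ch \<delta> z ws y" using Cons by auto
  have red: "length ws = len (wprod ws)"
    using reduced_tail[of a ws] Cons by simp
  then have "\<delta> z y = wprod ws" using Cons z by blast
  moreover have "len (a \<otimes> wprod ws) = len (wprod ws) + 1" using red Cons.prems by simp
  ultimately show ?case using WD2_longer[of z y x a] z Cons.hyps Cons.prems by simp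
qed

lemma gallery_rev:
  assumes "ws \<in> lists S" "x \<in> Ch" "gallery Ch \<delta> x ws y"
  shows "gallery Ch \<delta> y (rev ws) x"
  using assms
proof (induction ws arbitrary: x)
  case (Cons a ws)
  then obtain z where z: "z \<in> Ch" "\<delta> x z = a" "gallery Ch \<delta> z ws y" by auto
  then have "gallery Ch \<delta> z [a] x" using adj_sym[of x z a] Cons by auto
  moreover have "gallery Ch \<delta> y (rev ws) z" using Cons z by auto
  ultimately show ?case by (auto intro: gallery_append simp del: gallery.simps)
qed simp

text \<open>
  A gallery of reduced type determines the Weyl distance of its ends, and the reverse of a reduced
  word is reduced.
\<close>
lemma Weyl_inv:
  assumes "x \<in> Ch" "y \<in> Ch"
  shows "\<delta> y x = inv (\<delta> x y)"
proof -
  obtain ws where ws: "ws \<in> lists S" "wprod ws = \<delta> x y" "length ws = len (\<delta> x y)"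
    using ex_reduced_word[OF Weyl_closed[OF assms]] by blast
  then have "gallery Ch \<delta> x ws y" using ex_gallery[OF ws(1) assms] by simp
  then have "gallery Ch \<delta> y (rev ws) x" using gallery_rev[OF ws(1) assms(1)] by blast
  moreover have "rev ws \<in> lists S" using ws(1) by (auto simp: in_lists_conv_set)
  moreover have "length (rev ws) = len (wprod (rev ws))"
    using ws len_inv[OF Weyl_closed[OF assms]] by (simp add: wprod_rev)
  ultimately have "\<delta> y x = wprod (rev ws)" using Weyl_reduced_gallery[OF _ assms(2,1)] by blast
  then show ?thesis using ws by (simp add: wprod_rev)
qed

lemma Weyl_right_longer:
  assumes "x \<in> Ch" "y \<in> Ch" "y' \<in> Ch" "s \<in> S" "\<delta> y y' = s"
    and "len (\<delta> x y \<otimes> s) = len (\<delta> x y) + 1"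
  shows "\<delta> x y' = \<delta> x y \<otimes> s"
proof -
  have c: "\<delta> x y \<in> carrier W" using Weyl_closed assms by simp
  have "\<delta> y' y = s" using adj_sym[OF assms(2-5)] .
  moreover have "len (s \<otimes> \<delta> y x) = len (\<delta> y x) + 1"
    using c assms(4,6) Weyl_inv[OF assms(1,2)] by (simp add: len_inv len_mult_gen)
  ultimately have "\<delta> y' x = s \<otimes> \<delta> y x"
    using WD2_longer[OF assms(2,1,3,4)] by blast
  then have "\<delta> x y' = inv (s \<otimes> inv (\<delta> x y))"
    using Weyl_inv[OF assms(3,1)] Weyl_inv[OF assms(1,2)] by simp
  then show ?thesis using c assms(4) by (simp add: inv_mult_group)
qed

lemma Weyl_right_ex:
  assumes "x \<in> Ch" "y \<in> Ch" "s \<in> S"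
  obtains y' where "y' \<in> Ch" "\<delta> y y' = s" "\<delta> x y' = \<delta> x y \<otimes> s"
proof -
  have c: "\<delta> x y \<in> carrier W" using Weyl_closed assms by simp
  obtain y' where y': "y' \<in> Ch" "\<delta> y' y = s" "\<delta> y' x = s \<otimes> \<delta> y x"
    using WD3[OF assms(2,1,3)] by blast
  then have "\<delta> x y' = inv (s \<otimes> inv (\<delta> x y))"
    using Weyl_inv[OF y'(1) assms(1)] Weyl_inv[OF assms(1,2)] by simp
  then have "\<delta> x y' = \<delta> x y \<otimes> s" using c assms(3) by (simp add: inv_mult_group)
  then show ?thesis by (rule that[OF y'(1) adj_sym[OF y'(1) assms(2,3) y'(2)]])
qed

lemma panel_adjacent:
  assumes "s \<in> S" "c \<in> Ch" "x \<in> panel Ch \<delta> s c" "y \<in> panel Ch \<delta> s c" "x \<noteq> y"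
  shows "\<delta> x y = s"
proof -
  have Ch: "x \<in> Ch" "y \<in> Ch" and x: "x = c \<or> \<delta> c x = s" and y: "y = c \<or> \<delta> c y = s"
    using assms(3,4) unfolding panel_def by blast+
  consider "x = c" | "x \<noteq> c" "y = c" | "\<delta> c x = s" "\<delta> c y = s" using x y by blast
  then show ?thesis
  proof cases
    case 1
    then show ?thesis using y assms(5) by blast
  next
    case 2
    then show ?thesis using x adj_sym[OF assms(2) Ch(1) assms(1)] by blast
  next
    case 3
    have "\<delta> x c = s" using adj_sym[OF assms(2) Ch(1) assms(1) 3(1)] .
    then have "\<delta> x y = s \<otimes> s \<or> \<delta> x y = s"
      using WD2[OF assms(2) Ch(2) Ch(1) assms(1)] 3(2) by simp
    moreover have "\<delta> x y \<noteq> \<one>" using WD1[OF Ch] assms(5) by simp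
    ultimately show ?thesis using assms(1) by simp
  qed
qed

lemma panel_sym:
  assumes "s \<in> S" "c \<in> Ch" "d \<in> panel Ch \<delta> s c"
  shows "c \<in> panel Ch \<delta> s d"
  using assms adj_sym[of c d s] by (auto simp: panel_def)

lemma panel_eq:
  assumes "s \<in> S" "c \<in> Ch" "d \<in> panel Ch \<delta> s c"
  shows "panel Ch \<delta> s d = panel Ch \<delta> s c"
proof -
  have sub: "panel Ch \<delta> s d \<subseteq> panel Ch \<delta> s c" if "c \<in> Ch" "d \<in> panel Ch \<delta> s c" for c d
  proof
    fix x assume x: "x \<in> panel Ch \<delta> s d"
    have d: "d \<in> Ch" and c: "c \<in> panel Ch \<delta> s d"
      using that panel_sym[OF assms(1)] by (auto simp: panel_def)
    show "x \<in> panel Ch \<delta> s c"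
      using panel_adjacent[OF assms(1) d c x] x by (auto simp: panel_def)
  qed
  have "d \<in> Ch" "c \<in> panel Ch \<delta> s d"
    using assms panel_sym[OF assms] by (auto simp: panel_def)
  then show ?thesis using sub assms by blast
qed

text \<open>
  A chamber of the panel from which the step \<open>s\<close> leads farther away from \<open>x\<close> is the unique nearest
  one, since all others then have the same, longer, Weyl distance from \<open>x\<close>.
\<close>
lemma panel_gate:
  assumes "s \<in> S" "c \<in> Ch" "x \<in> Ch"
    and d: "d \<in> panel Ch \<delta> s c" "len (\<delta> x d \<otimes> s) = len (\<delta> x d) + 1"
  shows "proj W S \<delta> (panel Ch \<delta> s c) x = d"
    and "\<And>e. \<lbrakk>e \<in> panel Ch \<delta> s c; e \<noteq> d\<rbrakk> \<Longrightarrow> \<delta> x e = \<delta> x d \<otimes> s"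
proof -
  have dCh: "d \<in> Ch" using d by (simp add: panel_def)
  show far: "\<delta> x e = \<delta> x d \<otimes> s" if "e \<in> panel Ch \<delta> s c" "e \<noteq> d" for e
  proof -
    have "e \<in> Ch" using that by (simp add: panel_def)
    moreover have "\<delta> d e = s" using panel_adjacent[OF assms(1,2) d(1) that(1)] that by blast
    ultimately show ?thesis using Weyl_right_longer[of x d e s] assms d dCh by blast
  qed
  then have least: "len (\<delta> x d) < len (\<delta> x e)" if "e \<in> panel Ch \<delta> s c" "e \<noteq> d" for e
    using that d by simp
  show "proj W S \<delta> (panel Ch \<delta> s c) x = d"
    unfolding proj_def
  proof (rule the_equality)
    show "is_arg_min (\<lambda>z. len (\<delta> x z)) (\<lambda>z. z \<in> panel Ch \<delta> s c) d"
      unfolding is_arg_min_def using d least by (metis less_asym)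
    show "y = d" if "is_arg_min (\<lambda>z. len (\<delta> x z)) (\<lambda>z. z \<in> panel Ch \<delta> s c) y" for y
      using that d least unfolding is_arg_min_def by blast
  qed
qed

lemma panel_proj:
  assumes "s \<in> S" "c \<in> Ch" "x \<in> Ch"
  defines "d \<equiv> proj W S \<delta> (panel Ch \<delta> s c) x"
  shows "d \<in> panel Ch \<delta> s c" "len (\<delta> x d \<otimes> s) = len (\<delta> x d) + 1"
proof -
  have "c \<in> panel Ch \<delta> s c" using assms by (simp add: panel_def)
  then obtain e where e: "e \<in> panel Ch \<delta> s c"
    and least: "\<And>z. z \<in> panel Ch \<delta> s c \<Longrightarrow> len (\<delta> x e) \<le> len (\<delta> x z)"
    using ex_has_least_nat[of "\<lambda>z. z \<in> panel Ch \<delta> s c" c "\<lambda>z. len (\<delta> x z)"] by auto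
  have eCh: "e \<in> Ch" using e by (simp add: panel_def)
  obtain z where z: "z \<in> Ch" "\<delta> e z = s" "\<delta> x z = \<delta> x e \<otimes> s"
    using Weyl_right_ex[OF assms(3) eCh assms(1)] by blast
  then have "z \<in> panel Ch \<delta> s c"
    using panel_eq[OF assms(1,2) e] by (auto simp: panel_def)
  then have "len (\<delta> x e \<otimes> s) = len (\<delta> x e) + 1"
    using least[of z] z(3) len_mult_gen_cases[of "\<delta> x e" s] Weyl_closed[of x e] assms eCh by auto
  then show "d \<in> panel Ch \<delta> s c" "len (\<delta> x d \<otimes> s) = len (\<delta> x d) + 1"
    using panel_gate(1)[OF assms(1-3) e] e d_def by auto
qed

lemma wing_iff:
  assumes "s \<in> S" "c \<in> Ch" "d \<in> panel Ch \<delta> s c"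
  shows "x \<in> wing W S Ch \<delta> s d \<longleftrightarrow> x \<in> Ch \<and> proj W S \<delta> (panel Ch \<delta> s c) x = d"
  using panel_eq[OF assms] by (simp add: wing_def)


section \<open>Wings and tree-walls\<close>

abbreviation star :: "'a \<Rightarrow> 'a set" where
  "star s \<equiv> {s} \<union> {t \<in> S - {s}. t \<otimes> s = s \<otimes> t}"

lemma tree_wall_chambers:
  assumes "c \<in> Ch"
  shows "\<Union> (tree_wall W S Ch \<delta> s c) = residue Ch \<delta> (star s) c"
proof
  show "\<Union> (tree_wall W S Ch \<delta> s c) \<subseteq> residue Ch \<delta> (star s) c"
    by (auto simp: tree_wall_def Let_def)
  show "residue Ch \<delta> (star s) c \<subseteq> \<Union> (tree_wall W S Ch \<delta> s c)"
  proof
    fix x assume x: "x \<in> residue Ch \<delta> (star s) c"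
    then have "x \<in> Ch" using residue_closed assms by metis
    moreover have "panel Ch \<delta> s x \<subseteq> residue Ch \<delta> (star s) c"
      by (rule panel_subset_residue[OF assms x]) simp
    ultimately have "panel Ch \<delta> s x \<in> tree_wall W S Ch \<delta> s c"
      by (auto simp: tree_wall_def Let_def)
    moreover have "x \<in> panel Ch \<delta> s x" using \<open>x \<in> Ch\<close> by (simp add: panel_def)
    ultimately show "x \<in> \<Union> (tree_wall W S Ch \<delta> s c)" by blast
  qed
qed

text \<open>
  Let \<open>d\<close> and \<open>e\<close> be the projections of \<open>x\<close> and \<open>y\<close>, at distances \<open>w\<close> and \<open>w'\<close>. The distances
  from \<open>x\<close> to \<open>e\<close> and from \<open>y\<close> to \<open>d\<close> are \<open>w s\<close> and \<open>w' s\<close>; the step from \<open>x\<close> to \<open>y\<close> changes a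
  distance at most by the factor \<open>t\<close>. This forces \<open>w\<close> and \<open>w'\<close> to have equal length and the
  step to cross the same wall as \<open>s\<close> does at \<open>w\<close>.
\<close>
lemma adjacent_in_distinct_wings:
  assumes "s \<in> S" "t \<in> S" "c \<in> Ch" "x \<in> Ch" "y \<in> Ch" "\<delta> x y = t"
    and distinct: "proj W S \<delta> (panel Ch \<delta> s c) x \<noteq> proj W S \<delta> (panel Ch \<delta> s c) y"
  shows "t = s" "x \<in> residue Ch \<delta> (star s) c"
proof -
  define d where "d = proj W S \<delta> (panel Ch \<delta> s c) x"
  define e where "e = proj W S \<delta> (panel Ch \<delta> s c) y"
  define w where "w = \<delta> x d"
  define w' where "w' = \<delta> y e"
  have d: "d \<in> panel Ch \<delta> s c" "len (w \<otimes> s) = len w + 1"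
    using panel_proj[OF assms(1,3,4)] by (auto simp: d_def w_def)
  have e: "e \<in> panel Ch \<delta> s c" "len (w' \<otimes> s) = len w' + 1"
    using panel_proj[OF assms(1,3,5)] by (auto simp: e_def w'_def)
  have "d \<noteq> e" using distinct d_def e_def by simp
  have xe: "\<delta> x e = w \<otimes> s" and yd: "\<delta> y d = w' \<otimes> s"
    using panel_gate(2)[of s c x d e] panel_gate(2)[of s c y e d] d e \<open>d \<noteq> e\<close> assms
    by (auto simp: w_def w'_def)
  have dCh: "d \<in> Ch" and eCh: "e \<in> Ch" using d e by (auto simp: panel_def)
  have w: "w \<in> carrier W" and w': "w' \<in> carrier W"
    using Weyl_closed[of x d] Weyl_closed[of y e] assms(4,5) dCh eCh by (simp_all add: w_def w'_def)
  have yx: "\<delta> y x = t" using adj_sym[of x y t] assms by blast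
  have e_step: "w' = t \<otimes> (w \<otimes> s) \<or> w' = w \<otimes> s"
    using WD2[of x e y t] assms eCh yx xe w'_def by auto
  have d_step: "w' \<otimes> s = t \<otimes> w \<or> w' \<otimes> s = w"
    using WD2[of x d y t] assms dCh yx yd w_def by auto
  have lower: "len (w \<otimes> s) \<le> len (t \<otimes> (w \<otimes> s)) + 1"
    using len_gen_mult_le[of t "t \<otimes> (w \<otimes> s)"] w assms by simp
  have upper: "len (t \<otimes> w) \<le> len w + 1" using len_gen_mult_le w assms by simp
  have "len w \<le> len w'" using e_step lower d(2) by auto
  moreover have "len w' \<le> len w" using d_step upper e(2) by auto
  ultimately have eq: "len w' = len w" by simp
  have wall: "t \<otimes> w = w \<otimes> s"
  proof (rule folding)
    show "len (t \<otimes> w) = len w + 1" using d_step e(2) eq by auto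
    show "len (t \<otimes> (w \<otimes> s)) < len (w \<otimes> s)" using e_step d(2) eq by auto
  qed (use assms w in auto)
  have longer: "\<not> separates t w"
    using separates_iff[of w t] wall d(2) w assms by simp
  obtain ws where ws: "ws \<in> lists S" "wprod ws = w" "length ws = len w"
    using ex_reduced_word[OF w] by blast
  have letters: "t = s \<and> (\<forall>a \<in> set ws. a \<noteq> s \<and> a \<otimes> s = s \<otimes> a)"
    using wall_stabiliser_letters[of ws s t] ws wall longer assms by simp
  then show "t = s" by simp
  have rev: "rev ws \<in> lists S" using ws(1) by (auto simp: in_lists_conv_set)
  have "\<delta> d x = wprod (rev ws)"
    using Weyl_inv[of x d] wprod_rev ws dCh assms by (simp add: w_def)
  then have "gallery Ch \<delta> d (rev ws) x" using ex_gallery[OF rev dCh assms(4)] by blast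
  moreover have "set (rev ws) \<subseteq> star s" using letters ws(1) by (auto simp: in_lists_conv_set)
  ultimately have dx: "x \<in> residue Ch \<delta> (star s) d" by (rule gallery_residue[OF _ dCh])
  have "c \<in> residue Ch \<delta> (star s) c" by (simp add: residue_def)
  then have cd: "d \<in> residue Ch \<delta> (star s) c"
    using panel_subset_residue[of c Ch c \<delta> "star s" s] d(1) assms by auto
  show "x \<in> residue Ch \<delta> (star s) c" by (rule residue_trans[OF cd dx])
qed

text \<open>
  Induction along a path from \<open>c\<close> to \<open>x\<close> in the residue. A step of type \<open>s\<close> is compensated by
  moving \<open>d\<close> along the panel, because \<open>s\<close> commutes with the Weyl distance to \<open>d\<close>.
\<close>
lemma tree_wall_to_panel:
  assumes "s \<in> S" "c \<in> Ch" "x \<in> residue Ch \<delta> (star s) c"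
  shows "\<exists>d \<in> panel Ch \<delta> s c. \<exists>ws \<in> lists {t \<in> S - {s}. t \<otimes> s = s \<otimes> t}. \<delta> x d = wprod ws"
  using assms(3) unfolding residue_def mem_Collect_eq
proof (induction rule: rtrancl_induct)
  case base
  have "\<delta> c c = wprod []" using WD1 assms by simp
  then show ?case using assms by (intro bexI[of _ c] bexI[of _ "[]"]) (auto simp: panel_def)
next
  case (step y z)
  then obtain d ws where d: "d \<in> panel Ch \<delta> s c" and yd: "\<delta> y d = wprod ws"
    and ws: "ws \<in> lists {t \<in> S - {s}. t \<otimes> s = s \<otimes> t}" by auto
  have Ch: "y \<in> Ch" "z \<in> Ch" "d \<in> Ch" and t: "\<delta> y z \<in> star s"
    using step d by (auto simp: panel_def)
  define t where "t = \<delta> y z"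
  have tS: "t \<in> S" using t assms t_def by auto
  have zd: "\<delta> z d = t \<otimes> wprod ws \<or> \<delta> z d = wprod ws"
    using WD2[OF Ch(1,3,2) tS adj_sym[OF Ch(1,2) tS t_def[symmetric]]] yd by simp
  show ?case
  proof (cases "\<delta> z d = wprod ws")
    case True
    then show ?thesis using d ws by blast
  next
    case False
    then have zd: "\<delta> z d = t \<otimes> wprod ws" using zd by simp
    show ?thesis
    proof (cases "t = s")
      case True
      have w: "wprod ws \<in> carrier W"
        using yd Weyl_closed[of y d] Ch by simp
      obtain e where e: "e \<in> Ch" "\<delta> d e = s" "\<delta> z e = \<delta> z d \<otimes> s"
        using Weyl_right_ex[OF Ch(2,3) assms(1)] by blast
      have "\<delta> z e = wprod ws"
        using e(3) zd True not_separates_commuting(2)[OF ws assms(1)] w assms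
        by (metis gen_cancel_right)
      moreover have "e \<in> panel Ch \<delta> s c"
        using e panel_eq[OF assms(1,2) d] by (auto simp: panel_def)
      ultimately show ?thesis using ws by blast
    next
      case False
      then have "t # ws \<in> lists {t \<in> S - {s}. t \<otimes> s = s \<otimes> t}"
        using ws t t_def by auto
      moreover have "\<delta> z d = wprod (t # ws)" using zd by simp
      ultimately show ?thesis using d by blast
    qed
  qed
qed

text \<open>
  The projection \<open>d\<close> of \<open>x\<close> is at a distance \<open>w\<close> that commutes with \<open>s\<close> and is lengthened by
  \<open>s\<close>. So \<open>y\<close> is at distance \<open>s w = w s\<close> from \<open>d\<close>, which a step along the panel shortens again.
\<close>
lemma tree_wall_panel_wings:
  assumes "s \<in> S" "c \<in> Ch" "x \<in> residue Ch \<delta> (star s) c" "y \<in> Ch" "\<delta> x y = s"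
  shows "proj W S \<delta> (panel Ch \<delta> s c) x \<noteq> proj W S \<delta> (panel Ch \<delta> s c) y"
proof -
  have x: "x \<in> Ch" using residue_closed assms by metis
  obtain d ws where d: "d \<in> panel Ch \<delta> s c" and xd: "\<delta> x d = wprod ws"
    and ws: "ws \<in> lists {t \<in> S - {s}. t \<otimes> s = s \<otimes> t}"
    using tree_wall_to_panel[OF assms(1-3)] by blast
  have dCh: "d \<in> Ch" using d by (simp add: panel_def)
  have w: "wprod ws \<in> carrier W" using xd Weyl_closed[of x d] x dCh by simp
  have comm: "wprod ws \<otimes> s = s \<otimes> wprod ws" and nsep: "\<not> separates s (wprod ws)"
    using not_separates_commuting[OF ws assms(1)] by auto
  have longer: "len (s \<otimes> wprod ws) = len (wprod ws) + 1"
    using not_separates_lengthens w nsep assms by simp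
  then have "proj W S \<delta> (panel Ch \<delta> s c) x = d"
    using panel_gate(1)[OF assms(1,2) x d] xd comm by simp
  moreover have "\<delta> y d = s \<otimes> wprod ws"
    using WD2_longer[of x d y s] adj_sym[OF x assms(4,1,5)] x dCh assms(1,4) xd longer by simp
  then have "len (\<delta> y d \<otimes> s) \<noteq> len (\<delta> y d) + 1"
    using longer w assms comm by (metis gen_cancel_right less_add_one less_asym)
  then have "proj W S \<delta> (panel Ch \<delta> s c) y \<noteq> d"
    using panel_proj(2)[OF assms(1,2,4)] by auto
  ultimately show ?thesis by simp
qed


section \<open>The universal group is defined by a condition on panels\<close>

lemma local_action_cong:
  assumes "legal_coloring S Ch \<delta> t Y h" "x \<in> Ch" "\<And>y. y \<in> panel Ch \<delta> t x \<Longrightarrow> f y = g y"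
  shows "local_action Ch \<delta> t Y h f x = local_action Ch \<delta> t Y h g x"
proof -
  have "bij_betw h (panel Ch \<delta> t x) Y" using assms by (simp add: legal_coloring_def)
  then have "inv_into (panel Ch \<delta> t x) h y \<in> panel Ch \<delta> t x" if "y \<in> Y" for y
    using that by (metis bij_betw_imp_surj_on inv_into_into)
  moreover have "f x = g x" using assms(2,3) by (simp add: panel_def)
  ultimately show ?thesis using assms(3) by (auto simp: local_action_def)
qed

lemma identity_in_universal_group:
  assumes "\<And>t. t \<in> S \<Longrightarrow> legal_coloring S Ch \<delta> t (Y t) (h t)"
    and "\<And>t. t \<in> S \<Longrightarrow> transitive_perm_group (Y t) (G t)"
  shows "(\<lambda>x \<in> Ch. x) \<in> universal_group S Ch \<delta> Y h G"
proof -
  have "bij_betw (\<lambda>x \<in> Ch. x) Ch Ch" by (auto simp: bij_betw_def inj_on_def)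
  then have "(\<lambda>x \<in> Ch. x) \<in> Aut Ch \<delta>"
    by (auto simp: Aut_def BijGroup_def Bij_def)
  moreover have "local_action Ch \<delta> t (Y t) (h t) (\<lambda>x \<in> Ch. x) x \<in> G t"
    if t: "t \<in> S" and x: "x \<in> Ch" for t x
  proof -
    have bij: "bij_betw (h t) (panel Ch \<delta> t x) (Y t)"
      using assms(1)[OF t] x by (simp add: legal_coloring_def)
    have "local_action Ch \<delta> t (Y t) (h t) (\<lambda>x \<in> Ch. x) x
        = local_action Ch \<delta> t (Y t) (h t) (\<lambda>x. x) x"
      by (rule local_action_cong[OF assms(1)[OF t] x]) (simp add: panel_def)
    also have "\<dots> = (\<lambda>y \<in> Y t. y)"
      unfolding local_action_def
    proof (rule restrict_ext)
      fix y assume "y \<in> Y t"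
      then have "inv_into (panel Ch \<delta> t x) (h t) y \<in> panel Ch \<delta> t x"
        and "h t (inv_into (panel Ch \<delta> t x) (h t) y) = y"
        using bij by (metis bij_betw_imp_surj_on inv_into_into, metis bij_betw_inv_into_right)
      then show "restrict (h t) (panel Ch \<delta> t x) (inv_into (panel Ch \<delta> t x) (h t) y) = y"
        by simp
    qed
    also have "\<dots> = \<one>\<^bsub>BijGroup (Y t)\<^esub>" by (simp add: BijGroup_def)
    also have "\<dots> \<in> G t"
      using assms(2)[OF t] by (simp add: transitive_perm_group_def subgroup.one_closed)
    finally show ?thesis .
  qed
  ultimately show ?thesis by (simp add: universal_group_def)
qed

lemma universal_group_closed: "\<lbrakk>g \<in> universal_group S Ch \<delta> Y h G; x \<in> Ch\<rbrakk> \<Longrightarrow> g x \<in> Ch"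
  by (auto simp: universal_group_def Aut_def BijGroup_def Bij_def bij_betw_def)

lemma universal_group_Weyl:
  "\<lbrakk>g \<in> universal_group S Ch \<delta> Y h G; x \<in> Ch; y \<in> Ch\<rbrakk> \<Longrightarrow> \<delta> (g x) (g y) = \<delta> x y"
  by (simp add: universal_group_def Aut_def)

lemma universal_group_bij: "g \<in> universal_group S Ch \<delta> Y h G \<Longrightarrow> bij_betw g Ch Ch"
  by (simp add: universal_group_def Aut_def BijGroup_def Bij_def)

lemma universal_group_extensional:
  "g \<in> universal_group S Ch \<delta> Y h G \<Longrightarrow> g \<in> extensional Ch"
  by (simp add: universal_group_def Aut_def BijGroup_def Bij_def)

text \<open>
  The map \<open>f\<close> preserves adjacencies with their types, so it preserves galleries of reduced type,
  and with them the Weyl distance. It is onto because its image is closed under adjacency: on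
  each panel it is the restriction of an automorphism. The local actions of \<open>f\<close> are those of the
  elements with which it agrees.
\<close>
lemma universal_group_panelwise:
  assumes legal: "\<And>t. t \<in> S \<Longrightarrow> legal_coloring S Ch \<delta> t (Y t) (h t)"
    and "S \<noteq> {}" and ext: "f \<in> extensional Ch"
    and panelwise: "\<And>t x. \<lbrakk>t \<in> S; x \<in> Ch\<rbrakk>
      \<Longrightarrow> \<exists>g \<in> universal_group S Ch \<delta> Y h G. \<forall>y \<in> panel Ch \<delta> t x. f y = g y"
  shows "f \<in> universal_group S Ch \<delta> Y h G"
proof -
  have closed: "f x \<in> Ch" if x: "x \<in> Ch" for x
  proof -
    obtain t where "t \<in> S" using \<open>S \<noteq> {}\<close> by blast
    moreover have "x \<in> panel Ch \<delta> t x" using x by (simp add: panel_def)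
    ultimately show ?thesis using panelwise[of t x] x universal_group_closed by metis
  qed
  have adj: "\<delta> (f x) (f y) = \<delta> x y" if "x \<in> Ch" "y \<in> Ch" "\<delta> x y \<in> S" for x y
  proof -
    have "x \<in> panel Ch \<delta> (\<delta> x y) x" "y \<in> panel Ch \<delta> (\<delta> x y) x"
      using that by (auto simp: panel_def)
    then show ?thesis using panelwise[of "\<delta> x y" x] that universal_group_Weyl by metis
  qed
  have gal: "gallery Ch \<delta> (f x) ws (f y)"
    if "ws \<in> lists S" "x \<in> Ch" "gallery Ch \<delta> x ws y" for ws x y
    using that
  proof (induction ws arbitrary: x)
    case (Cons a ws)
    then obtain z where z: "z \<in> Ch" "\<delta> x z = a" "gallery Ch \<delta> z ws y" by auto
    then show ?case using Cons adj[of x z] closed[of z] by auto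
  qed simp
  have iso: "\<delta> (f x) (f y) = \<delta> x y" if "x \<in> Ch" "y \<in> Ch" for x y
  proof -
    obtain ws where ws: "ws \<in> lists S" "wprod ws = \<delta> x y" "length ws = len (\<delta> x y)"
      using ex_reduced_word[OF Weyl_closed[OF \<open>x \<in> Ch\<close> \<open>y \<in> Ch\<close>]] by blast
    then have "gallery Ch \<delta> (f x) ws (f y)" using ex_gallery[OF ws(1) that] gal[OF ws(1) that(1)] by simp
    then show ?thesis
      using Weyl_reduced_gallery[OF ws(1) closed[OF that(1)] closed[OF that(2)]] ws by simp
  qed
  have inj: "inj_on f Ch"
  proof (rule inj_onI)
    fix x y assume "x \<in> Ch" "y \<in> Ch" "f x = f y"
    then show "x = y" using iso[of x y] WD1 closed by metis
  qed
  \<comment> \<open>galleries that start in the image of \<open>f\<close> stay in it\<close>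
  have reach: "y \<in> f ` Ch" if "ws \<in> lists S" "x \<in> Ch" "gallery Ch \<delta> (f x) ws y" for ws x y
    using that
  proof (induction ws arbitrary: x)
    case (Cons a ws)
    then obtain z where z: "z \<in> Ch" "\<delta> (f x) z = a" "gallery Ch \<delta> z ws y" by auto
    obtain g where g: "g \<in> universal_group S Ch \<delta> Y h G" "\<And>y. y \<in> panel Ch \<delta> a x \<Longrightarrow> f y = g y"
      using panelwise[of a x] Cons by blast
    obtain z' where z': "z' \<in> Ch" "g z' = z"
      using universal_group_bij[OF g(1)] z(1) by (metis bij_betw_imp_surj_on imageE)
    have "f x = g x" using g Cons.prems by (simp add: panel_def)
    then have "\<delta> x z' = a"
      using universal_group_Weyl[OF g(1) _ z'(1)] Cons.prems z z' by auto
    then have "f z' = z" using g(2)[of z'] z' by (simp add: panel_def)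
    then show ?case using Cons.IH[of z'] z z' by simp
  qed auto
  have "f ` Ch = Ch"
  proof
    show "f ` Ch \<subseteq> Ch" using closed by auto
    show "Ch \<subseteq> f ` Ch"
    proof
      fix y assume y: "y \<in> Ch"
      obtain ws where "ws \<in> lists S" "wprod ws = \<delta> (f y) y"
        using ex_word[OF Weyl_closed[OF closed[OF y] y]] by blast
      then show "y \<in> f ` Ch" using reach[of ws y y] ex_gallery[of ws "f y" y] closed y by simp
    qed
  qed
  then have "f \<in> Aut Ch \<delta>"
    using inj iso ext by (simp add: Aut_def BijGroup_def Bij_def bij_betw_def)
  moreover have "local_action Ch \<delta> t (Y t) (h t) f x \<in> G t" if "t \<in> S" "x \<in> Ch" for t x
  proof -
    obtain g where g: "g \<in> universal_group S Ch \<delta> Y h G" "\<And>y. y \<in> panel Ch \<delta> t x \<Longrightarrow> f y = g y"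
      using panelwise[OF \<open>t \<in> S\<close> \<open>x \<in> Ch\<close>] by blast
    then have "local_action Ch \<delta> t (Y t) (h t) f x = local_action Ch \<delta> t (Y t) (h t) g x"
      by (intro local_action_cong legal that)
    then show ?thesis using g(1) that by (simp add: universal_group_def)
  qed
  ultimately show ?thesis by (simp add: universal_group_def)
qed


section \<open>Gluing along a tree-wall\<close>

lemma universal_group_glue_wings:
  assumes legal: "\<And>t. t \<in> S \<Longrightarrow> legal_coloring S Ch \<delta> t (Y t) (h t)"
    and trans: "\<And>t. t \<in> S \<Longrightarrow> transitive_perm_group (Y t) (G t)"
    and s: "s \<in> S" and c: "c \<in> Ch" and ext: "f \<in> extensional Ch"
    and \<gamma>: "\<And>d. d \<in> panel Ch \<delta> s c \<Longrightarrow> \<gamma> d \<in> universal_group S Ch \<delta> Y h G"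
    and fixes_wall: "\<And>d x. \<lbrakk>d \<in> panel Ch \<delta> s c; x \<in> residue Ch \<delta> (star s) c\<rbrakk> \<Longrightarrow> \<gamma> d x = x"
    and f: "\<And>x. x \<in> Ch \<Longrightarrow> f x = \<gamma> (proj W S \<delta> (panel Ch \<delta> s c) x) x"
  shows "f \<in> universal_group S Ch \<delta> Y h G"
proof (rule universal_group_panelwise[OF legal _ ext])
  show "S \<noteq> {}" using s by auto
  let ?p = "proj W S \<delta> (panel Ch \<delta> s c)"
  fix t x assume t: "t \<in> S" and x: "x \<in> Ch"
  show "\<exists>g \<in> universal_group S Ch \<delta> Y h G. \<forall>y \<in> panel Ch \<delta> t x. f y = g y"
  proof (cases "\<forall>y \<in> panel Ch \<delta> t x. ?p y = ?p x")
    case True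
    then show ?thesis
      using f \<gamma>[OF panel_proj(1)[OF s c x]] by (intro bexI[of _ "\<gamma> (?p x)"]) (auto simp: panel_def)
  next
    case False
    then obtain y where y: "y \<in> panel Ch \<delta> t x" "?p y \<noteq> ?p x" by blast
    then have "y \<in> Ch" "\<delta> x y = t" by (auto simp: panel_def)
    then have wall: "t = s" "x \<in> residue Ch \<delta> (star s) c"
      using adjacent_in_distinct_wings[OF s t c x, of y] y by auto
    have "panel Ch \<delta> t x \<subseteq> residue Ch \<delta> (star s) c"
      by (rule panel_subset_residue[OF c wall(2)]) (simp add: wall(1))
    then have "f z = z" if "z \<in> panel Ch \<delta> t x" for z
      using that f[of z] fixes_wall[OF panel_proj(1)[OF s c, of z]] by (auto simp: panel_def)
    then show ?thesis
      using identity_in_universal_group[OF legal trans]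
      by (intro bexI[of _ "\<lambda>x \<in> Ch. x"]) (auto simp: panel_def)
  qed
qed

text \<open>
  Only a chamber \<open>x\<close> in the wing of \<open>d\<close> needs an argument. The other chambers of its
  \<open>s\<close>-panel lie in other wings, so \<open>g\<close> fixes them (and there is at least one). Hence \<open>g x\<close> is in
  this panel too, and being distinct from \<open>x\<close> it would be fixed, against injectivity.
\<close>
lemma V_group_fixes_tree_wall:
  assumes s: "s \<in> S" and c: "c \<in> Ch" and d: "d \<in> panel Ch \<delta> s c"
    and g: "g \<in> V_group W S Ch \<delta> (universal_group S Ch \<delta> Y h G) s d"
    and x: "x \<in> residue Ch \<delta> (star s) c"
  shows "g x = x"
proof (cases "x \<in> wing W S Ch \<delta> s d")
  case True
  have gU: "g \<in> universal_group S Ch \<delta> Y h G"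
    and outside: "\<And>v. \<lbrakk>v \<in> Ch; v \<notin> wing W S Ch \<delta> s d\<rbrakk> \<Longrightarrow> g v = v"
    using g by (auto simp: V_group_def)
  have xCh: "x \<in> Ch" using True by (simp add: wing_def)
  have neighbour_fixed: "g y = y" if "y \<in> Ch" "\<delta> x y = s" for y
  proof (rule outside[OF that(1)])
    show "y \<notin> wing W S Ch \<delta> s d"
      using tree_wall_panel_wings[OF s c x that] True wing_iff[OF s c d] by simp
  qed
  obtain y where y: "y \<in> Ch" "\<delta> x y = s" using Weyl_right_ex[OF xCh xCh s] by blast
  have gx: "g x \<in> Ch" using universal_group_closed gU xCh by blast
  have "\<delta> (g x) y = s"
    using universal_group_Weyl[OF gU xCh y(1)] neighbour_fixed[OF y] y(2) by simp
  then have "x \<in> panel Ch \<delta> s y" "g x \<in> panel Ch \<delta> s y"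
    using adj_sym[of x y s] adj_sym[of "g x" y s] y xCh gx s by (simp_all add: panel_def)
  then have "g x = x \<or> \<delta> x (g x) = s" using panel_adjacent[OF s y(1), of x "g x"] by metis
  then show ?thesis
    using neighbour_fixed[OF gx] universal_group_bij[OF gU] xCh gx by (metis bij_betw_def inj_onD)
next
  case False
  then show ?thesis using g residue_closed[OF c x] by (simp add: V_group_def)
qed

end

theorem proposition3p16:
  fixes W :: "('w, 'm) monoid_scheme" and S :: "'w set"
    and Ch :: "'c set" and \<delta> :: "'c \<Rightarrow> 'c \<Rightarrow> 'w"
    and q :: "'w \<Rightarrow> 'k rel" and Y :: "'w \<Rightarrow> 'y set"
    and h :: "'w \<Rightarrow> 'c \<Rightarrow> 'y" and G :: "'w \<Rightarrow> ('y \<Rightarrow> 'y) set"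
    and s :: 'w and c :: 'c
  assumes "semi_regular_right_angled_building W S Ch \<delta> q"
    and "\<And>t. t \<in> S \<Longrightarrow> |Y t| =o q t"
    and "\<And>t. t \<in> S \<Longrightarrow> legal_coloring S Ch \<delta> t (Y t) (h t)"
    and "\<And>t. t \<in> S \<Longrightarrow> transitive_perm_group (Y t) (G t)"
    and "U = universal_group S Ch \<delta> Y h G"
    and "c \<in> Ch" and "s \<in> S"
    and "T = tree_wall W S Ch \<delta> s c"
  shows "Fix U T = prod_V W S Ch \<delta> U s c"
proof -
  interpret semi_regular_right_angled_building W S Ch \<delta> q by fact
  note legal = assms(3) and trans = assms(4) and U = assms(5) and c = assms(6) and s = assms(7)
  let ?p = "proj W S \<delta> (panel Ch \<delta> s c)"
  have T: "\<Union> T = residue Ch \<delta> (star s) c" using tree_wall_chambers[OF c] assms(8) by simp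
  show ?thesis
  proof (intro equalityI subsetI)
    fix g assume "g \<in> Fix U T"
    then have gU: "g \<in> U" and fixed: "\<And>x. x \<in> residue Ch \<delta> (star s) c \<Longrightarrow> g x = x"
      using T by (auto simp: Fix_def)
    define \<gamma> where "\<gamma> = (\<lambda>d \<in> panel Ch \<delta> s c. \<lambda>x \<in> Ch. if ?p x = d then g x else x)"
    have "\<gamma> d \<in> V_group W S Ch \<delta> U s d" if d: "d \<in> panel Ch \<delta> s c" for d
    proof -
      have "\<gamma> d \<in> universal_group S Ch \<delta> Y h G"
      proof (rule universal_group_glue_wings[OF legal trans s c,
            where \<gamma> = "\<lambda>e. if e = d then g else (\<lambda>x \<in> Ch. x)"])
        show "(if e = d then g else (\<lambda>x \<in> Ch. x)) \<in> universal_group S Ch \<delta> Y h G" for e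
          using gU U identity_in_universal_group[OF legal trans] by auto
        show "(if e = d then g else (\<lambda>x \<in> Ch. x)) x = x"
          if "x \<in> residue Ch \<delta> (star s) c" for e x
          using fixed[OF that] residue_closed[OF c that] by simp
      qed (auto simp: \<gamma>_def d)
      then show ?thesis using U wing_iff[OF s c d] d by (auto simp: V_group_def \<gamma>_def)
    qed
    then have "\<gamma> \<in> carrier (product_group (panel Ch \<delta> s c)
        (\<lambda>d. (BijGroup Ch)\<lparr>carrier := V_group W S Ch \<delta> U s d\<rparr>))"
      by (auto simp: \<gamma>_def)
    moreover have "\<forall>d \<in> panel Ch \<delta> s c. \<forall>x \<in> wing W S Ch \<delta> s d. g x = \<gamma> d x"
      using wing_iff[OF s c] by (auto simp: \<gamma>_def)
    moreover have "g \<in> extensional Ch" using gU U universal_group_extensional by blast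
    ultimately show "g \<in> prod_V W S Ch \<delta> U s c" unfolding prod_V_def by blast
  next
    fix g assume "g \<in> prod_V W S Ch \<delta> U s c"
    then obtain \<gamma> where ext: "g \<in> extensional Ch"
      and \<gamma>: "\<And>d. d \<in> panel Ch \<delta> s c \<Longrightarrow> \<gamma> d \<in> V_group W S Ch \<delta> U s d"
      and g: "\<And>d x. \<lbrakk>d \<in> panel Ch \<delta> s c; x \<in> wing W S Ch \<delta> s d\<rbrakk> \<Longrightarrow> g x = \<gamma> d x"
      by (auto simp: prod_V_def PiE_iff)
    have fixed: "\<gamma> d x = x" if "d \<in> panel Ch \<delta> s c" "x \<in> residue Ch \<delta> (star s) c" for d x
      using V_group_fixes_tree_wall[OF s c that(1) _ that(2)] \<gamma>[OF that(1)] U by blast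
    have gp: "g x = \<gamma> (?p x) x" if "x \<in> Ch" for x
      using g panel_proj(1)[OF s c that] wing_iff[OF s c] that by blast
    have "g \<in> U" unfolding U
      by (rule universal_group_glue_wings[OF legal trans s c ext, where \<gamma> = \<gamma>])
        (use \<gamma> U fixed gp in \<open>auto simp: V_group_def\<close>)
    moreover have "g x = x" if "x \<in> residue Ch \<delta> (star s) c" for x
      using gp fixed panel_proj(1)[OF s c] residue_closed[OF c that] that by simp
    ultimately show "g \<in> Fix U T" using T by (auto simp: Fix_def)
  qed
qed

end
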